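(* Let $R$ be a ring with unit $1$ and let $a,b$ be nonzero elements of $R$ such that the Drazin inverses $a^D$ and $b^D$ exist. Put $s=\mathrm{ind}(a)$, $t=\mathrm{ind}(b)$ and $a^\pi=1-aa^D$. Suppose that $K(a,b)=bb^D+aa^D-1$ is invertible in $R$. Then for any integers $l\ge s$ and $k\ge t$, writing $E_{k,l}=b^k-a^l$, the following hold: (1) $1+(a^D)^l(b^k-a^l)$ is invertible in $R$ and $b^kR\cap(1-a^Da)R=\{0\}$. (2) $W_{k,l}=1+E_{k,l}Z_{k,l}(1+(a^D)^lE_{k,l})^{-1}(a^D)^l$ is invertible in $R$, where $Z_{k,l}=a^\pi E_{k,l}(a^D)^l(1+E_{k,l}(a^D)^l)^{-1}$. (3) $b^D=(1+Z_{k,l})\big[H_{k,l}+H_{k,l}^2E_{k,l}a^\pi\big](1-Z_{k,l})\,b^{k-1}$, where $H_{k,l}=(1+(a^D)^lE_{k,l})^{-1}(a^D)^lW_{k,l}^{-1}$.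
   Context: $R$ is not necessarily commutative. For $x\in R$, the Drazin inverse $x^D$ is the (unique, if it exists) element $y\in R$ such that $yxy=y$, $xy=yx$ and $x^myx=x^m$ for some positive integer $m$; the smallest such positive integer $m$ is the index $\mathrm{ind}(x)$. For $x\in R$, $xR=\{xr:r\in R\}$. In this setting $1+E_{k,l}(a^D)^l$ is invertible if and only if $1+(a^D)^lE_{k,l}$ is invertible. *)

theory Defs
  imports Main
begin

definition ring_unit :: "'a::ring_1 \<Rightarrow> bool" where
  "ring_unit x \<longleftrightarrow> (\<exists>y. x * y = 1 \<and> y * x = 1)"

text \<open>Only meaningful if \<open>ring_unit x\<close> holds; the two-sided inverse is then unique.\<close>

definition unit_inv :: "'a::ring_1 \<Rightarrow> 'a" where
  "unit_inv x = (THE y. x * y = 1 \<and> y * x = 1)"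

definition is_drazin_inverse :: "'a::ring_1 \<Rightarrow> 'a \<Rightarrow> bool" where
  "is_drazin_inverse x y \<longleftrightarrow>
     y * x * y = y \<and> x * y = y * x \<and> (\<exists>m::nat. m > 0 \<and> x ^ m * y * x = x ^ m)"

definition drazin_invertible :: "'a::ring_1 \<Rightarrow> bool" where
  "drazin_invertible x \<longleftrightarrow> (\<exists>y. is_drazin_inverse x y)"

definition drazin_inverse :: "'a::ring_1 \<Rightarrow> 'a" where
  "drazin_inverse x = (THE y. is_drazin_inverse x y)"

text \<open>The index is positive by convention: a unit has index 1, not 0.\<close>

definition drazin_index :: "'a::ring_1 \<Rightarrow> nat" where
  "drazin_index x = (LEAST m. m > 0 \<and> x ^ m * drazin_inverse x * x = x ^ m)"

definition principal_right_ideal :: "'a::ring_1 \<Rightarrow> 'a set" where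
  "principal_right_ideal x = {x * r | r. True}"

lemma unit_inv_eqI:
  assumes "x * y = 1" "y * x = 1"
  shows "unit_inv x = y"
  unfolding unit_inv_def
proof (rule the_equality)
  fix z assume "x * z = 1 \<and> z * x = 1"
  then have "z = z * (x * y)" "z * x = 1" using assms by simp_all
  then show "z = y" by (simp add: mult.assoc [symmetric])
qed (use assms in simp)

lemma drazin_aux:
  assumes "is_drazin_inverse x y"
  shows "y = y ^ Suc n * x ^ n" and "x * y = y * x"
    and "\<exists>m. x ^ m * y * x = x ^ m"
proof -
  have c: "x * y = y * x" and yxy: "y * x * y = y"
    using assms by (auto simp: is_drazin_inverse_def)
  show "x * y = y * x" by (fact c)
  show "\<exists>m. x ^ m * y * x = x ^ m" using assms by (auto simp: is_drazin_inverse_def)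
  show "y = y ^ Suc n * x ^ n"
  proof (induction n)
    case (Suc n)
    have "y ^ Suc (Suc n) * x ^ Suc n = y * (y ^ Suc n * x ^ n) * x"
      by (simp only: power_Suc2 [of x] power_Suc [of y "Suc n"] mult.assoc)
    also have "\<dots> = y * y * x" using Suc by simp
    also have "\<dots> = y" using yxy c by (simp add: mult.assoc)
    finally show ?case by simp
  qed simp
qed

lemma drazin_inverse_unique:
  assumes y: "is_drazin_inverse x y" and z: "is_drazin_inverse x z"
  shows "y = z"
proof -
  have half: "u = u * x * v"
    if u: "is_drazin_inverse x u" and v: "is_drazin_inverse x v" for u v
  proof -
    obtain m where m: "x ^ m * v * x = x ^ m" using drazin_aux(3) [OF v] by blast
    have "u * x * v = u ^ Suc m * x ^ m * x * v" using drazin_aux(1) [OF u, of m] by simp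
    also have "\<dots> = u ^ Suc m * (x ^ m * v * x)"
      using drazin_aux(2) [OF v] by (simp only: mult.assoc)
    also have "\<dots> = u" using m drazin_aux(1) [OF u, of m] by simp
    finally show ?thesis by simp
  qed
  have half': "v = u * x * v"
    if u: "is_drazin_inverse x u" and v: "is_drazin_inverse x v" for u v
  proof -
    obtain m where m: "x ^ m * u * x = x ^ m" using drazin_aux(3) [OF u] by blast
    have cv: "x ^ i * v ^ j = v ^ j * x ^ i" for i j
      using drazin_aux(2) [OF v]
      by (metis power_commuting_commutes)
    have cu: "u * x ^ i = x ^ i * u" for i
      using drazin_aux(2) [OF u] by (metis power_commuting_commutes)
    have e: "v = x ^ m * v ^ Suc m" using drazin_aux(1) [OF v, of m] cv [of m "Suc m"] by (simp del: power_Suc)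
    have "u * x * v = u * x * (x ^ m * v ^ Suc m)" using e by simp
    also have "\<dots> = (x ^ m * u * x) * v ^ Suc m"
      using cu [of "Suc m"] drazin_aux(2) [OF u]
      by (metis mult.assoc power_Suc power_Suc2)
    also have "\<dots> = v" using m e by simp
    finally show ?thesis by simp
  qed
  show ?thesis using half [OF y z] half' [OF y z] by simp
qed

lemma drazin_inverse_eqI: "is_drazin_inverse x y \<Longrightarrow> drazin_inverse x = y"
  unfolding drazin_inverse_def by (blast intro: drazin_inverse_unique)

end

theory Submission
  imports Defs
begin

text \<open>
  Write \<open>p = a a\<^sup>D\<close>, \<open>q = b b\<^sup>D\<close>, \<open>A = a\<^sup>l\<close>, \<open>B = b\<^sup>k\<close>, and let \<open>y\<close>, \<open>c\<close> be the group inverses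
  of \<open>A\<close>, \<open>B\<close>. With \<open>K = p + q - 1\<close> we have \<open>p K = p q = K q\<close> and \<open>K p = q p = q K\<close>, so
  \<open>x = K\<^sup>-\<^sup>1 c K\<^sup>-\<^sup>1\<close> lies in the corner ring at \<open>p\<close>, is the inverse of \<open>p B p\<close> there, and satisfies
  \<open>B x B = B\<close> (the Schur complement of \<open>p B p\<close> in \<open>B\<close> vanishes). Now
  \<open>(1 + y E)\<^sup>-\<^sup>1 y = x = y (1 + E y)\<^sup>-\<^sup>1\<close>, which gives \<open>Z = B x - p\<close> and \<open>H = p q x\<close>; the asserted
  expression for the Drazin inverse collapses to \<open>q x q b\<^sup>k\<^sup>-\<^sup>1 = c b\<^sup>k\<^sup>-\<^sup>1\<close>. Both invertibility
  claims reduce, via \<open>1 + u v\<close> versus \<open>1 + v u\<close>, to invertibility in the corner ring.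
\<close>

section \<open>Units of a ring and of its corners\<close>

lemma ring_unitI: "x * y = 1 \<Longrightarrow> y * x = 1 \<Longrightarrow> ring_unit x"
  by (auto simp: ring_unit_def)

lemma ring_unit_unit_inv:
  assumes "ring_unit x"
  shows "x * unit_inv x = 1" and "unit_inv x * x = 1"
  using assms unit_inv_eqI by (auto simp: ring_unit_def)

lemma unit_inv_mult_eqI:
  assumes "ring_unit x" and "x * v = w"
  shows "unit_inv x * w = v"
  using ring_unit_unit_inv(2) [OF assms(1)] assms(2) by (metis mult.assoc mult_1)

lemma mult_unit_inv_eqI:
  assumes "ring_unit x" and "v * x = w"
  shows "w * unit_inv x = v"
  using ring_unit_unit_inv(1) [OF assms(1)] assms(2) by (metis mult.assoc mult_1_right)

text \<open>Jacobson's lemma: if \<open>r\<close> inverts \<open>1 + u * v\<close>, then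
  \<open>1 - v * r * u\<close> inverts \<open>1 + v * u\<close>.\<close>

lemma ring_unit_one_plus_swap:
  fixes u v :: "'a::ring_1"
  assumes "ring_unit (1 + u * v)"
  shows "ring_unit (1 + v * u)"
proof -
  obtain r where r1: "(1 + u * v) * r = 1" and r2: "r * (1 + u * v) = 1"
    using assms by (auto simp: ring_unit_def)
  have e1: "u * (v * r) = 1 - r" and e2: "r * (u * v) = 1 - r"
    using r1 r2 by (simp_all add: algebra_simps eq_diff_eq)
  have e1': "u * (v * (r * w)) = w - r * w" for w
    using e1 by (metis left_diff_distrib mult.assoc mult_1)
  have e2': "r * (u * (v * w)) = w - r * w" for w
    using e2 by (metis left_diff_distrib mult.assoc mult_1)
  show ?thesis
    by (rule ring_unitI [where y = "1 - v * r * u"]) (simp_all add: algebra_simps e1' e2')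
qed

text \<open>Peirce decomposition: \<open>g\<close> is a unit of the corner at \<open>p\<close>, and
  \<open>1 - p\<close> is the identity of the complementary corner.\<close>

lemma ring_unit_corner:
  fixes p g h :: "'a::ring_1"
  assumes "p * p = p" "p * g = g" "g * p = g" "p * h = h" "h * p = h" "g * h = p" "h * g = p"
  shows "ring_unit (1 - p + g)"
  by (rule ring_unitI [where y = "1 - p + h"]) (simp_all add: algebra_simps assms)

section \<open>Drazin inverses and powers\<close>

lemma drazin_inverse_props:
  fixes x :: "'a::ring_1"
  assumes "drazin_invertible x"
  defines "d \<equiv> drazin_inverse x"
  shows "d * x * d = d" and "x * d = d * x" and "drazin_index x > 0"
    and "drazin_index x \<le> n \<Longrightarrow> x ^ n * d * x = x ^ n"
proof -
  have d: "is_drazin_inverse x d"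
    using assms by (auto simp: drazin_invertible_def dest: drazin_inverse_eqI)
  then show "d * x * d = d" "x * d = d * x" by (auto simp: is_drazin_inverse_def)
  have "\<exists>m>0. x ^ m * d * x = x ^ m" using d by (auto simp: is_drazin_inverse_def)
  then have ind: "drazin_index x > 0 \<and> x ^ drazin_index x * d * x = x ^ drazin_index x"
    unfolding drazin_index_def d_def by (rule LeastI_ex)
  then show "drazin_index x > 0" by simp
  show "x ^ n * d * x = x ^ n" if "drazin_index x \<le> n"
  proof -
    have "x ^ n = x ^ (n - drazin_index x) * x ^ drazin_index x"
      using that by (simp flip: power_add)
    then show ?thesis using ind by (simp add: mult.assoc)
  qed
qed

text \<open>Reduces Drazin inverses to group inverses: from the index on, \<open>x ^ n\<close> has
  group inverse \<open>d ^ n\<close>, and the last identity recovers \<open>d\<close>.\<close>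

lemma drazin_power_props:
  fixes x :: "'a::ring_1"
  assumes "drazin_invertible x" and n: "drazin_index x \<le> n"
  defines "d \<equiv> drazin_inverse x"
  shows "x ^ n * d ^ n = x * d" and "d ^ n * x ^ n = x * d"
    and "x * d * x ^ n = x ^ n" and "x ^ n * (x * d) = x ^ n"
    and "x * d * d ^ n = d ^ n" and "d ^ n * (x * d) = d ^ n"
    and "x * d * (x * d) = x * d" and "d ^ n * x ^ (n - 1) = d"
proof -
  note props = drazin_inverse_props [OF assms(1), folded d_def]
  have c: "x * d = d * x" and dxd: "d * x * d = d" by (fact props)+
  obtain m where m: "n = Suc m" using props(3) n by (cases n) auto
  have cx: "x ^ i * d = d * x ^ i" for i
    using c by (metis power_commuting_commutes)
  have cd: "d ^ i * x = x * d ^ i" for i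
    using c by (metis power_commuting_commutes)
  show idem: "x * d * (x * d) = x * d" using dxd by (simp add: mult.assoc)
  have pn: "(x * d) ^ Suc i = x * d" for i
    by (induction i) (simp_all add: idem)
  have pow: "x ^ i * d ^ i = (x * d) ^ i" for i
  proof (induction i)
    case (Suc i)
    have "x ^ Suc i * d ^ Suc i = x * (x ^ i * d) * d ^ i" by (simp add: mult.assoc)
    also have "\<dots> = x * d * (x ^ i * d ^ i)" by (simp add: cx mult.assoc)
    finally show ?case using Suc by simp
  qed simp
  show xd: "x ^ n * d ^ n = x * d" using pow [of n] pn m by simp
  have comm: "x ^ i * d ^ j = d ^ j * x ^ i" for i j
    using cx by (metis power_commuting_commutes)
  show "d ^ n * x ^ n = x * d" using xd comm by simp
  show r: "x ^ n * (x * d) = x ^ n" using props(4) [OF n] c by (simp add: mult.assoc)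
  show "x * d * x ^ n = x ^ n" using r cx [of n] c by (metis mult.assoc power_commutes)
  have pd: "x * d * d = d" using dxd c by simp
  show "x * d * d ^ n = d ^ n" using pd m by (simp flip: mult.assoc)
  show "d ^ n * (x * d) = d ^ n" using \<open>x * d * d ^ n = d ^ n\<close> cd [of n] c
    by (metis mult.assoc power_commutes)
  have "d ^ n * x ^ (n - 1) = d * (d ^ m * x ^ m)" using m by (simp add: mult.assoc)
  also have "\<dots> = d * (x * d) ^ m" using pow comm by simp
  also have "\<dots> = d" using pn dxd by (cases m) (simp_all add: mult.assoc)
  finally show "d ^ n * x ^ (n - 1) = d" .
qed

text \<open>\<open>y\<close> and \<open>c\<close> are the group inverses of \<open>A\<close> and \<open>B\<close>, with spectral idempotents \<open>1 - p\<close> and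
  \<open>1 - q\<close>; \<open>J\<close> is the inverse of \<open>K = p + q - 1\<close>.\<close>

locale group_invertible_pair =
  fixes A y p B c q J :: "'a::ring_1"
  assumes Ay: "A * y = p" and yA: "y * A = p" and pA: "p * A = A" and Ap: "A * p = A"
    and py: "p * y = y" and yp: "y * p = y" and pp: "p * p = p"
    and Bc: "B * c = q" and cB: "c * B = q" and qB: "q * B = B" and Bq: "B * q = B"
    and qc: "q * c = c" and cq: "c * q = c" and qq: "q * q = q"
    and KJ: "(q + p - 1) * J = 1" and JK: "J * (q + p - 1) = 1"
begin

definition "x = J * c * J"
definition "E = B - A"
definition "Z = (1 - p) * E * y * unit_inv (1 + E * y)"
definition "W = 1 + E * Z * unit_inv (1 + y * E) * y"
definition "H = unit_inv (1 + y * E) * y * unit_inv W"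

section \<open>Intertwining of \<open>p\<close> and \<open>q\<close>, and the corner inverse
  \<open>x\<close>\<close>

lemma pK: "p * (q + p - 1) = p * q" and Kq: "(q + p - 1) * q = p * q"
  and Kp: "(q + p - 1) * p = q * p" and qK: "q * (q + p - 1) = q * p"
  by (simp_all add: algebra_simps pp qq)

lemma pJ: "p * J = J * q" and qJ: "q * J = J * p"
proof -
  \<comment> \<open>With \<open>K = q + p - 1\<close>, this is \<open>K * p = q * K\<close>
    multiplied by \<open>J\<close> on both sides.\<close>
  have "J * ((q + p - 1) * p) * J = J * (q * (q + p - 1)) * J" using Kp qK by simp
  then show "p * J = J * q" using KJ JK by (metis mult.assoc mult_1 mult_1_right)
  have "J * ((q + p - 1) * q) * J = J * (p * (q + p - 1)) * J" using Kq pK by simp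
  then show "q * J = J * p" using KJ JK by (metis mult.assoc mult_1 mult_1_right)
qed

text \<open>With \<open>K = q + p - 1\<close>:
  \<open>q * J * q = J * p * q = J * K * q\<close>.\<close>

lemma qJq: "q * J * q = q"
  using qJ Kq JK by (metis mult.assoc mult_1)

lemma BJc: "B * J * c = q" and cJB: "c * J * B = q"
  using qJq Bq qc Bc cq qB cB by (metis mult.assoc)+

lemma px: "p * x = x" and xp: "x * p = x"
  unfolding x_def using pJ qJ qc cq by (metis mult.assoc)+

lemma pBx: "p * B * x = p"
proof -
  have "p * B * x = p * (B * J * c) * J" by (simp add: x_def mult.assoc)
  also have "\<dots> = p * (q + p - 1) * J" by (simp only: BJc pK)
  finally show ?thesis using KJ by (simp add: mult.assoc)
qed

lemma xBp: "x * B * p = p"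
proof -
  have "x * B * p = J * (c * J * B) * p" by (simp add: x_def mult.assoc)
  also have "\<dots> = J * ((q + p - 1) * p)" by (simp only: cJB Kp) (simp only: mult.assoc)
  finally show ?thesis using JK by (simp flip: mult.assoc)
qed

lemma BxB: "B * x * B = B"
proof -
  have "B * x * B = (B * J * c) * J * B" by (simp add: x_def mult.assoc)
  also have "\<dots> = q * J * q * B" by (simp only: BJc) (metis qB mult.assoc)
  finally show ?thesis by (simp add: qJq qB)
qed

lemma Bxq: "B * x * q = q"
  using BxB Bc by (metis mult.assoc)

lemma qxB: "q * x * B = q"
  using BxB cB by (metis mult.assoc)

lemma yBx: "y * B * x = y" and xBy: "x * B * y = y" and ABx: "A * B * x = A"
  using pBx xBp yp py Ap by (metis mult.assoc)+

lemmas prods = Ay yA pA Ap py yp pp Bc cB qB Bq qc cq qq px xp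
  pBx [unfolded mult.assoc] xBp [unfolded mult.assoc] BxB [unfolded mult.assoc]
  Bxq [unfolded mult.assoc] qxB [unfolded mult.assoc]
  yBx [unfolded mult.assoc] xBy [unfolded mult.assoc] ABx [unfolded mult.assoc]

text \<open>Lets a two-factor rule fire inside a longer product, since products are nested to the
  right; \<open>mult_eq_left3\<close> does the same for three factors.\<close>

lemma mult_eq_left2: "u * v = w \<Longrightarrow> u * (v * z) = w * z" for u v w z :: 'a
  by (simp flip: mult.assoc)

lemma mult_eq_left3: "u * (v * t) = w \<Longrightarrow> u * (v * (t * z)) = w * z" for u v w t z :: 'a
  by (simp flip: mult.assoc)

lemmas rules = prods prods [THEN mult_eq_left2] prods(17-) [THEN mult_eq_left3]

section \<open>Units and closed forms for \<open>Z\<close>, \<open>W\<close> and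
  \<open>H\<close>\<close>

lemma unit_yE: "ring_unit (1 + y * E)"
proof -
  have "ring_unit (1 - p + y * B * p)"
    \<comment> \<open>In the corner at \<open>p\<close>, the inverse of \<open>y\<close> is
      \<open>A\<close> and that of \<open>p * B * p\<close> is \<open>x\<close>.\<close>
    by (rule ring_unit_corner [where h = "x * A"]) (simp_all add: mult.assoc rules)
  moreover have "1 - p + y * B * p = 1 + (y * E) * p"
    by (simp add: E_def algebra_simps rules)
  ultimately have "ring_unit (1 + p * (y * E))"
    using ring_unit_one_plus_swap by metis
  then show ?thesis by (simp add: rules)
qed

lemma unit_Ey: "ring_unit (1 + E * y)"
  using unit_yE by (rule ring_unit_one_plus_swap)

text \<open>\<open>(1 + y * E) * x = x + y * B * x - p * x = y\<close>.\<close>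

lemma inv_yE: "unit_inv (1 + y * E) * y = x"
  using unit_yE
  by (rule unit_inv_mult_eqI) (simp add: E_def algebra_simps rules)

lemma inv_Ey: "y * unit_inv (1 + E * y) = x"
  using unit_Ey
  by (rule mult_unit_inv_eqI) (simp add: E_def algebra_simps rules)

lemma Z_eq: "Z = B * x - p"
proof -
  have "Z = (1 - p) * E * x" by (simp add: Z_def inv_Ey mult.assoc)
  then show ?thesis by (simp add: E_def algebra_simps rules)
qed

lemma W_eq: "W = 1 + B * (B * (x * x)) - B * x"
proof -
  have "W = 1 + E * Z * x" by (simp add: W_def inv_yE mult.assoc)
  then show ?thesis by (simp add: Z_eq E_def algebra_simps rules)
qed

lemma unit_W: "ring_unit W"
proof -
  define s where "s = B * (B * (x * x)) - B * x"
  have "ring_unit (1 - p + p * B * B * x * x)"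
  \<comment> \<open>The element is \<open>p * B * B * x\<close> times \<open>x\<close>; in the
    corner these have inverses \<open>p * q * x\<close> and \<open>p * B * p\<close>.\<close>
  proof (rule ring_unit_corner [where h = "p * B * p * q * x"])
    have pxB: "x * (B * (p * w)) = p * w" for w
      by (metis xBp mult.assoc)
    show "p * B * B * x * x * (p * B * p * q * x) = p"
      by (simp add: mult.assoc rules pxB)
    show "p * B * p * q * x * (p * B * B * x * x) = p"
      by (simp add: mult.assoc rules)
  qed (simp_all add: mult.assoc rules)
  moreover have "1 - p + p * B * B * x * x = 1 + p * s"
    by (simp add: s_def algebra_simps rules)
  ultimately have "ring_unit (1 + s * p)"
    using ring_unit_one_plus_swap by metis
  moreover have "s * p = s"
    by (simp add: s_def left_diff_distrib mult.assoc rules)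
  moreover have "W = 1 + s"
    by (simp add: W_eq s_def)
  ultimately show ?thesis by simp
qed

lemma H_eq: "H = p * q * x"
proof -
  \<comment> \<open>By \<open>q * x * B = q\<close> the terms \<open>p * q * x\<close> cancel,
    leaving \<open>p * B * x * x = x\<close>.\<close>
  have "p * q * x * W = x"
    by (simp add: W_eq algebra_simps rules)
  then have "x * unit_inv W = p * q * x"
    by (rule mult_unit_inv_eqI [OF unit_W])
  then show ?thesis by (simp add: H_def inv_yE)
qed

lemma group_inverse_formula: "(1 + Z) * (H + H\<^sup>2 * E * (1 - p)) * (1 - Z) = c"
proof -
  have "(1 + Z) * H = q * x"
    by (simp add: Z_eq H_eq algebra_simps rules)
  \<comment> \<open>\<open>A * (1 - p) = 0\<close> reduces \<open>E\<close> to \<open>B\<close>,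
    which \<open>q * x * B = q\<close> absorbs.\<close>
  moreover have "(H + H\<^sup>2 * E * (1 - p)) = H * (1 + q - q * p)"
    by (simp add: H_eq E_def power2_eq_square algebra_simps rules)
  moreover have "(1 + q - q * p) * (1 - Z) = 1 + p + q - B * x - B * x"
    by (simp add: Z_eq algebra_simps rules)
  ultimately have "(1 + Z) * (H + H\<^sup>2 * E * (1 - p)) * (1 - Z)
      = q * x * (1 + p + q - B * x - B * x)"
    by (metis mult.assoc)
  \<comment> \<open>\<open>x * p = x\<close> and \<open>q * x * B = q\<close> turn the other terms
    into copies of \<open>q * x\<close> that cancel.\<close>
  also have "\<dots> = q * x * q"
    by (simp add: algebra_simps rules)
  also have "\<dots> = c"
    by (metis qxB Bc qc mult.assoc)
  finally show ?thesis .
qed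

text \<open>On the intersection \<open>q\<close> acts as the identity and \<open>p\<close> as zero,
  so the invertible \<open>q + p - 1\<close> kills it.\<close>

lemma ideals_Int: "principal_right_ideal B \<inter> principal_right_ideal (1 - p) = {0}"
proof -
  have "z = 0" if z1: "z = B * r" and z2: "z = (1 - p) * r'" for z r r'
  proof -
    have "q * z = z" using z1 by (simp add: rules)
    moreover have "p * z = 0" unfolding z2 by (simp add: algebra_simps rules)
    ultimately have "(q + p - 1) * z = 0" by (simp add: algebra_simps)
    then show ?thesis using JK by (metis mult.assoc mult_1 mult_zero_right)
  qed
  moreover have "0 = B * 0" "0 = (1 - p) * 0" by simp_all
  ultimately show ?thesis unfolding principal_right_ideal_def by blast
qed

end

theorem corollary3p5:
  fixes a b :: "'a::ring_1" and k l :: nat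
  assumes "a \<noteq> 0" and "b \<noteq> 0"
    and "drazin_invertible a" and "drazin_invertible b"
    and "ring_unit (b * drazin_inverse b + a * drazin_inverse a - 1)"
    and "l \<ge> drazin_index a" and "k \<ge> drazin_index b"
  shows
    "let aD = drazin_inverse a;
         a\<pi> = 1 - a * aD;
         E = b ^ k - a ^ l;
         Z = a\<pi> * E * aD ^ l * unit_inv (1 + E * aD ^ l);
         W = 1 + E * Z * unit_inv (1 + aD ^ l * E) * aD ^ l;
         H = unit_inv (1 + aD ^ l * E) * aD ^ l * unit_inv W
     in (ring_unit (1 + aD ^ l * (b ^ k - a ^ l)) \<and>
           principal_right_ideal (b ^ k) \<inter> principal_right_ideal (1 - aD * a) = {0}) \<and>
        ring_unit W \<and>
        drazin_inverse b = (1 + Z) * (H + H ^ 2 * E * a\<pi>) * (1 - Z) * b ^ (k - 1)"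
proof -
  define aD bD where "aD = drazin_inverse a" and "bD = drazin_inverse b"
  define J where "J = unit_inv (b * bD + a * aD - 1)"
  note A = drazin_power_props [OF assms(3,6), folded aD_def]
  note B = drazin_power_props [OF assms(4,7), folded bD_def]
  interpret group_invertible_pair "a ^ l" "aD ^ l" "a * aD" "b ^ k" "bD ^ k" "b * bD" J
  proof
    show "(b * bD + a * aD - 1) * J = 1" "J * (b * bD + a * aD - 1) = 1"
      using ring_unit_unit_inv [OF assms(5)] by (simp_all add: J_def aD_def bD_def)
  qed (rule A B)+
  have comm: "aD * a = a * aD"
    using drazin_inverse_props(2) [OF assms(3)] by (simp add: aD_def)
  \<comment> \<open>The formula yields \<open>bD ^ k\<close>, and
    \<open>bD ^ k * b ^ (k - 1) = bD\<close>; here \<open>k > 0\<close> because the index is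
    positive.\<close>
  have "bD = (1 + Z) * (H + H\<^sup>2 * E * (1 - a * aD)) * (1 - Z) * b ^ (k - 1)"
    by (simp only: group_inverse_formula B(8))
  then show ?thesis
    using unit_yE ideals_Int unit_W
    unfolding Let_def aD_def [symmetric] bD_def [symmetric] comm
    unfolding H_def W_def Z_def E_def
    by blast
qed

end
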